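(* Let $n\ge 3$ and let $p_n(x)=\det(xI-C)$ be the characteristic polynomial of the $n\times n$ affine Cartan matrix $C$ of type $A_{n-1}^{(1)}$. Then $$p_n(x)=\sum_{j=1}^{n}(-1)^{n+j}\,\frac{2n\,(n+j-1)!}{(n-j)!\,(2j)!}\,x^j .$$
   Context: The $n\times n$ matrix $C=(C_{i,j})_{1\le i,j\le n}$ of type $A_{n-1}^{(1)}$ has $C_{i,i}=2$ for all $i$, $C_{i,i+1}=C_{i+1,i}=-1$ for $1\le i\le n-1$, $C_{1,n}=C_{n,1}=-1$, and all other entries $0$. *)

theory Defs
  imports "Jordan_Normal_Form.Char_Poly"
begin

(* Rows and columns of type mat are indexed by 0, ..., n - 1, so the entry C_{i,j} of the
   usual 1-based convention is found at index (i - 1, j - 1); the corner entries C_{1,n} and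
   C_{n,1} are at (0, n - 1) and (n - 1, 0).  Meant for n >= 3. *)
definition affine_cartan_A :: "nat \<Rightarrow> real mat" where
  "affine_cartan_A n = mat n n (\<lambda>(i, j).
     if i = j then 2
     else if j = i + 1 \<or> i = j + 1 \<or> (i = 0 \<and> j = n - 1) \<or> (i = n - 1 \<and> j = 0) then -1
     else 0)"

end

theory Submission imports Defs begin

text \<open>
  The affine Cartan matrix of type \<open>A\<close> is \<open>C = 2 I - P - P\<^sup>T\<close> for the cyclic shift \<open>P\<close>. Since
  \<open>P\<close> is orthogonal, \<open>(z I - P) (z I - P)\<^sup>T = z (C - x I)\<close> at \<open>x = 2 - z - 1 / z\<close>. The substitution
  thus splits the characteristic polynomial \<open>p\<close> of \<open>C\<close> into two factors that are both the
  characteristic polynomial \<open>z ^ n - 1\<close> of the shift, and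
  \<open>(- z) ^ n p(2 - z - 1 / z) = (z ^ n - 1)\<^sup>2\<close>. Equivalently,
  \<open>p(- w) = (- 1) ^ n (z ^ n + z ^ (- n) - 2)\<close> for \<open>w = z + 1 / z - 2\<close>.

  It remains to express \<open>z ^ n + z ^ (- n)\<close> as a polynomial in \<open>w\<close>, a shifted Chebyshev polynomial.
  The three-term recurrence in \<open>n\<close> becomes a recurrence for the coefficients, which is
  solved by a sum of two binomial coefficients (\<open>power_plus_inverse_power\<close>). The factorials of the
  closed formula come from that sum, and the subtracted \<open>2\<close> cancels the constant term. Since
  \<open>2 - z - 1 / z\<close> takes infinitely many values, agreement at these values is equality
  of polynomials.
\<close>

section \<open>The cyclic shift\<close>

definition cyclic_shift :: "nat \<Rightarrow> 'a :: comm_ring_1 mat" where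
  "cyclic_shift n = mat n n (\<lambda>(i, j). of_bool (j = Suc i mod n))"

lemma cyclic_shift_carrier [simp]: "cyclic_shift n \<in> carrier_mat n n"
  by (simp add: cyclic_shift_def)

lemma cyclic_shift_dim [simp]: "dim_row (cyclic_shift n) = n" "dim_col (cyclic_shift n) = n"
  by (simp_all add: cyclic_shift_def)

text \<open>
  The first column has only two nonzero entries. Deleting the row of either leaves a triangular
  matrix: upper triangular with diagonal \<open>z\<close> for the top entry, lower triangular with diagonal
  \<open>- 1\<close> for the bottom one. Splitting the column as \<open>z e\<^sub>0 - e\<^sub>m\<close> with \<open>m = n - 1\<close> covers the case
  \<open>n = 1\<close>, in which the two entries coincide.
\<close>
lemma det_scalar_minus_cyclic_shift:
  fixes z :: "'a :: comm_ring_1"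
  assumes "n \<ge> 1"
  shows "det (z \<cdot>\<^sub>m 1\<^sub>m n - cyclic_shift n) = z ^ n - 1"
proof -
  define A where "A = z \<cdot>\<^sub>m 1\<^sub>m n - cyclic_shift n"
  define m where "m = n - 1"
  have n: "n = Suc m"
    using assms by (simp add: m_def)
  have A: "A \<in> carrier_mat n n"
    by (simp add: A_def minus_carrier_mat)
  have entry: "A $$ (i, j) = (if i = j then z else 0) - of_bool (j = (if i = m then 0 else Suc i))"
    if "i < n" "j < n" for i j
    using that by (auto simp: A_def cyclic_shift_def n)
  have col0: "A $$ (i, 0) = (if i = 0 then z else 0) - (if i = m then 1 else 0)" if "i < n" for i
    using that by (auto simp: entry n)
  have minor_carrier: "mat_delete A i 0 \<in> carrier_mat m m" for i
    using mat_delete_carrier[OF A, of i 0] n by simp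
  have "det (mat_delete A 0 0) = prod_list (diag_mat (mat_delete A 0 0))"
  proof (rule det_upper_triangular[OF _ minor_carrier])
    show "upper_triangular (mat_delete A 0 0)"
      using A n unfolding upper_triangular_def by (auto simp: mat_delete_def entry)
  qed
  also have "\<dots> = (\<Prod>i = 0..<m. z)"
    unfolding prod_list_diag_prod using minor_carrier[of 0] A n
    by (intro prod.cong) (auto simp: mat_delete_def entry)
  finally have first: "det (mat_delete A 0 0) = z ^ m" by simp
  have "det (mat_delete A m 0) = prod_list (diag_mat (mat_delete A m 0))"
  proof (rule det_lower_triangular[OF _ minor_carrier])
    show "mat_delete A m 0 $$ (i, j) = 0" if "i < j" "j < m" for i j
      using that A n by (auto simp: mat_delete_def entry)
  qed
  also have "\<dots> = (\<Prod>i = 0..<m. - 1)"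
    unfolding prod_list_diag_prod using minor_carrier[of m] A n
    by (intro prod.cong) (auto simp: mat_delete_def entry)
  finally have last: "det (mat_delete A m 0) = (- 1) ^ m" by simp
  have "det A = (\<Sum>i<n. A $$ (i, 0) * cofactor A i 0)"
    by (rule laplace_expansion_column[OF A]) (simp add: n)
  also have "\<dots> = (\<Sum>i<n. (if i = 0 then z * cofactor A i 0 else 0) - (if i = m then cofactor A i 0 else 0))"
    by (rule sum.cong) (auto simp: col0 algebra_simps)
  also have "\<dots> = z * z ^ m - (- 1) ^ m * (- 1) ^ m"
    by (simp add: sum_subtractf n cofactor_def first last)
  also have "\<dots> = z ^ n - 1"
    by (simp add: n flip: power_mult_distrib)
  finally show ?thesis
    by (simp add: A_def)
qed

section \<open>The characteristic polynomial under the substitution x = 2 - z - 1/z\<close>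

text \<open>
  Expanding the product gives \<open>z\<^sup>2 I - z (P + P\<^sup>T) + P P\<^sup>T\<close> with \<open>P P\<^sup>T = I\<close>. For \<open>n = 2\<close> the entries
  of \<open>P\<close> and \<open>P\<^sup>T\<close> off the diagonal would coincide and add up to \<open>2\<close>; for \<open>n \<ge> 3\<close> they are disjoint,
  so that \<open>P + P\<^sup>T\<close> is the adjacency matrix of the \<open>n\<close>-cycle.
\<close>
lemma affine_cartan_gram_factorisation:
  fixes z :: real
  assumes "n \<ge> 3" and "z \<noteq> 0"
  defines "A \<equiv> z \<cdot>\<^sub>m 1\<^sub>m n - cyclic_shift n"
  shows "A * A\<^sup>T = (- z) \<cdot>\<^sub>m (- char_matrix (affine_cartan_A n) (2 - z - 1 / z))"
proof (rule eq_matI)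
  define s where "s i = Suc i mod n" for i
  have s_less: "s i < n" for i
    using assms by (simp add: s_def)
  fix i j :: nat
  assume "i < dim_row ((- z) \<cdot>\<^sub>m (- char_matrix (affine_cartan_A n) (2 - z - 1 / z)))"
    and "j < dim_col ((- z) \<cdot>\<^sub>m (- char_matrix (affine_cartan_A n) (2 - z - 1 / z)))"
  then have ij: "i < n" "j < n"
    by (simp_all add: char_matrix_def affine_cartan_A_def)
  have "(A * A\<^sup>T) $$ (i, j)
      = (\<Sum>k = 0..<n. (z * of_bool (k = i) - of_bool (k = s i)) * (z * of_bool (k = j) - of_bool (k = s j)))"
    using ij by (auto simp: A_def cyclic_shift_def scalar_prod_def s_def intro!: sum.cong)
  also have "\<dots> = (\<Sum>k = 0..<n. (if k = i then z * (z * of_bool (k = j) - of_bool (k = s j)) else 0)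
      - (if k = s i then z * of_bool (k = j) - of_bool (k = s j) else 0))"
    by (rule sum.cong) (auto simp: algebra_simps)
  also have "\<dots> = z * (z * of_bool (i = j) - of_bool (i = s j)) - (z * of_bool (s i = j) - of_bool (s i = s j))"
    using ij s_less by (simp add: sum_subtractf)
  also have "\<dots> = (if i = j then z\<^sup>2 + 1 else if i = s j \<or> j = s i then - z else 0)"
    using ij assms(1) by (auto simp: s_def mod_Suc power2_eq_square split: if_splits)
  also have "\<dots> = ((- z) \<cdot>\<^sub>m (- char_matrix (affine_cartan_A n) (2 - z - 1 / z))) $$ (i, j)"
    using ij assms(1,2)
    by (auto simp: s_def mod_Suc char_matrix_def affine_cartan_A_def field_simps power2_eq_square)
  finally show "(A * A\<^sup>T) $$ (i, j)
      = ((- z) \<cdot>\<^sub>m (- char_matrix (affine_cartan_A n) (2 - z - 1 / z))) $$ (i, j)" .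
qed (simp_all add: A_def char_matrix_def affine_cartan_A_def)

text \<open>
  Determinants of the factorisation: the left side contributes \<open>det (z I - P)\<close> twice, as a matrix
  and its transpose have the same determinant.
\<close>
lemma poly_char_poly_affine_cartan:
  fixes z :: real
  assumes "n \<ge> 3" and "z \<noteq> 0"
  shows "(- z) ^ n * poly (char_poly (affine_cartan_A n)) (2 - z - 1 / z) = (z ^ n - 1)\<^sup>2"
proof -
  define A where "A = z \<cdot>\<^sub>m 1\<^sub>m n - cyclic_shift n"
  define C where "C = affine_cartan_A n"
  have A: "A \<in> carrier_mat n n" and C: "C \<in> carrier_mat n n"
    by (simp_all add: A_def C_def affine_cartan_A_def minus_carrier_mat)
  have "(- z) ^ n * poly (char_poly C) (2 - z - 1 / z)
      = det ((- z) \<cdot>\<^sub>m (- char_matrix C (2 - z - 1 / z)))"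
    using C by (simp add: char_poly_matrix[OF C] char_matrix_def)
  also have "\<dots> = det (A * A\<^sup>T)"
    using affine_cartan_gram_factorisation[OF assms] by (simp add: A_def C_def)
  also have "\<dots> = (det A)\<^sup>2"
    using A by (simp add: det_mult[of _ n] det_transpose power2_eq_square)
  also have "\<dots> = (z ^ n - 1)\<^sup>2"
    using assms by (simp add: A_def det_scalar_minus_cyclic_shift)
  finally show ?thesis
    by (simp add: C_def)
qed

section \<open>Power sums z^n + z^(-n) as polynomials in z + 1/z - 2\<close>

text \<open>
  For \<open>n \<ge> 1\<close> this is \<open>2 n / (n + j)\<close> times \<open>n + j choose 2 * j\<close>, as in the coefficients
  of Lucas polynomials; the sum of two binomial coefficients stays in the natural numbers and
  inherits a recurrence from the Pascal rule. At \<open>n = j = 0\<close> the truncated subtraction gives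
  the value \<open>2 = z ^ 0 + z ^ 0\<close> needed there.
\<close>
definition lucas_coeff :: "nat \<Rightarrow> nat \<Rightarrow> nat" where
  "lucas_coeff n j = ((n + j) choose (2 * j)) + ((n + j - 1) choose (2 * j))"

lemma choose_second_difference:
  "(Suc (Suc m) choose Suc (Suc k)) + (m choose Suc (Suc k))
    = 2 * (Suc m choose Suc (Suc k)) + (m choose k)"
  by simp

text \<open>
  This is the recurrence \<open>V (n + 2) + V n = (w + 2) V (n + 1)\<close> read off at the coefficient of
  \<open>w ^ (j + 1)\<close>; it is the second difference of binomial coefficients, once for each summand
  of the coefficients.
\<close>
lemma lucas_coeff_rec:
  "lucas_coeff (Suc (Suc n)) (Suc j) + lucas_coeff n (Suc j)
    = 2 * lucas_coeff (Suc n) (Suc j) + lucas_coeff (Suc n) j"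
  using choose_second_difference[of "Suc (n + j)" "2 * j"]
    choose_second_difference[of "n + j" "2 * j"]
  by (simp add: lucas_coeff_def del: binomial_Suc_Suc)

lemma lucas_coeff_eq_0: "n < j \<Longrightarrow> lucas_coeff n j = 0"
  by (auto simp: lucas_coeff_def)

text \<open>
  Both sides satisfy \<open>V (n + 2) = (w + 2) V (n + 1) - V n\<close> with \<open>w + 2 = z + 1 / z\<close>. The common
  upper limit \<open>N\<close>, beyond which all coefficients vanish, lets the three sums in the recurrence
  range over the same indices.
\<close>
lemma power_plus_inverse_power:
  fixes z :: "'a :: field"
  assumes "z \<noteq> 0" and "n \<le> N"
  shows "z ^ n + inverse z ^ n
       = (\<Sum>j\<le>N. of_nat (lucas_coeff n j) * (z + inverse z - 2) ^ j)"
  using assms(2)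
proof (induction n rule: induct_nat_012)
  case 0
  have "(\<Sum>j\<le>N. of_nat (lucas_coeff 0 j) * (z + inverse z - 2) ^ j)
      = (\<Sum>j\<in>{0}. of_nat (lucas_coeff 0 j) * (z + inverse z - 2) ^ j)"
    by (rule sum.mono_neutral_right) (auto simp: lucas_coeff_eq_0)
  then show ?case by (simp add: lucas_coeff_def)
next
  case 1
  have "(\<Sum>j\<le>N. of_nat (lucas_coeff 1 j) * (z + inverse z - 2) ^ j)
      = (\<Sum>j\<in>{0, 1}. of_nat (lucas_coeff 1 j) * (z + inverse z - 2) ^ j)"
    using 1 by (intro sum.mono_neutral_right) (auto simp: lucas_coeff_eq_0)
  then show ?case by (simp add: lucas_coeff_def choose_two)
next
  case (ge2 n)
  define w where "w = z + inverse z - 2"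
  define S where "S n = (\<Sum>j\<le>N. of_nat (lucas_coeff n j) * w ^ j)" for n
  obtain M where M: "N = Suc M"
    using ge2.prems by (cases N) auto
  have split: "S k = 2 + (\<Sum>j\<le>M. of_nat (lucas_coeff k (Suc j)) * w ^ Suc j)" for k
    unfolding S_def M by (subst sum.atMost_Suc_shift) (simp add: lucas_coeff_def)
  have "S (Suc (Suc n)) + S n
      = 4 + (\<Sum>j\<le>M. of_nat (lucas_coeff (Suc (Suc n)) (Suc j) + lucas_coeff n (Suc j)) * w ^ Suc j)"
    by (simp add: split sum.distrib distrib_right)
  also have "\<dots> = 2 * S (Suc n) + w * (\<Sum>j\<le>M. of_nat (lucas_coeff (Suc n) j) * w ^ j)"
    unfolding lucas_coeff_rec
    by (simp add: split sum.distrib sum_distrib_left algebra_simps)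
  also have "(\<Sum>j\<le>M. of_nat (lucas_coeff (Suc n) j) * w ^ j) = S (Suc n)"
    using ge2.prems by (simp add: S_def M lucas_coeff_eq_0)
  finally have "S (Suc (Suc n)) = (w + 2) * S (Suc n) - S n"
    by (simp add: algebra_simps)
  also have "\<dots> = (z + inverse z) * (z ^ Suc n + inverse z ^ Suc n) - (z ^ n + inverse z ^ n)"
    using ge2 by (simp add: S_def w_def)
  also have "\<dots> = z ^ Suc (Suc n) + inverse z ^ Suc (Suc n)"
    using assms(1) by (simp add: algebra_simps) (simp flip: mult.assoc)
  finally show ?case
    by (simp add: S_def w_def)
qed

text \<open>
  Over the common denominator \<open>(n - j)! (2 j)!\<close> the numerators add up to
  \<open>((n + j) + (n - j)) (n + j - 1)!\<close>, hence the factor \<open>2 n\<close>. In the case \<open>j = n\<close> the second binomial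
  coefficient vanishes and has no factorial formula.
\<close>
lemma lucas_coeff_eq_fact:
  assumes "1 \<le> j" and "j \<le> n"
  shows "real (lucas_coeff n j) = 2 * real n * fact (n + j - 1) / (fact (n - j) * fact (2 * j))"
proof -
  obtain k where k: "n = j + k" using assms le_Suc_ex by blast
  obtain i where i: "j = Suc i" using assms by (cases j) auto
  have 1: "real ((n + j) choose (2 * j)) = fact (n + j) / (fact (2 * j) * fact (n - j))"
    using assms by (subst binomial_fact) (auto simp: k)
  have f: "(fact (n + j) :: real) = real (n + j) * fact (n + j - 1)"
    using assms by (intro fact_reduce) auto
  show ?thesis
  proof (cases "k = 0")
    case True
    then show ?thesis using 1 f k i by (simp add: lucas_coeff_def binomial_eq_0)
  next
    case False
    have 2: "real ((n + j - 1) choose (2 * j)) = fact (n + j - 1) / (fact (2 * j) * fact (n + j - 1 - 2 * j))"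
      using False i by (subst binomial_fact) (auto simp: k)
    have "n + j - 1 - 2 * j = k - 1" using k by simp
    moreover have "(fact (n - j) :: real) = real k * fact (k - 1)"
      using False k by (simp add: fact_reduce)
    ultimately show ?thesis
      using False k unfolding lucas_coeff_def of_nat_add 1 2 f
      by (simp add: divide_simps) (simp add: algebra_simps)
  qed
qed

section \<open>The coefficients of the characteristic polynomial\<close>

text \<open>
  The only points identified by \<open>z + 1 / z\<close> are \<open>z\<close> and \<open>1 / z\<close>, so it is injective beyond \<open>1\<close>.
\<close>
lemma infinite_range_two_minus_plus_inverse:
  "infinite ((\<lambda>z::real. 2 - z - 1 / z) ` {1<..})"
proof
  assume "finite ((\<lambda>z::real. 2 - z - 1 / z) ` {1<..})"
  moreover have "inj_on (\<lambda>z::real. 2 - z - 1 / z) {1<..}"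
  proof (rule inj_onI)
    fix z u :: real
    assume zu: "z \<in> {1<..}" "u \<in> {1<..}" and "2 - z - 1 / z = 2 - u - 1 / u"
    then have "(z - u) * (z * u - 1) = 0"
      by (simp add: field_simps)
    moreover have "z * u > 1"
      using zu less_1_mult by auto
    ultimately show "z = u" by simp
  qed
  ultimately show False
    using finite_imageD infinite_Ioi by blast
qed

theorem proposition1:
  fixes n :: nat
  assumes "n \<ge> 3"
  shows "char_poly (affine_cartan_A n) =
    (\<Sum>j = 1..n. monom ((-1) ^ (n + j) * (2 * real n * fact (n + j - 1) / (fact (n - j) * fact (2 * j)))) j)"
    (is "?p = ?q")
proof -
  have agree: "poly ?p (2 - z - 1 / z) = poly ?q (2 - z - 1 / z)" if "z > 1" for z :: real
  proof -
    define w where "w = z + inverse z - 2"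
    have x: "2 - z - 1 / z = - w"
      by (simp add: w_def inverse_eq_divide)
    have "poly ?q (- w) = (\<Sum>j = 1..n. (- 1) ^ (n + j) * real (lucas_coeff n j) * (- w) ^ j)"
      by (auto simp: poly_sum poly_monom lucas_coeff_eq_fact intro!: sum.cong)
    also have "\<dots> = (- 1) ^ n * (\<Sum>j = 1..n. real (lucas_coeff n j) * w ^ j)"
      unfolding sum_distrib_left
      by (rule sum.cong) (auto simp: power_add power_minus[of w])
    \<comment> \<open>The coefficient of \<open>w ^ 0\<close> is \<open>2\<close>.\<close>
    also have "(\<Sum>j = 1..n. real (lucas_coeff n j) * w ^ j) = (\<Sum>j\<le>n. real (lucas_coeff n j) * w ^ j) - 2"
      by (simp add: atMost_atLeast0 sum.atLeast_Suc_atMost lucas_coeff_def)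
    also have "\<dots> = z ^ n + inverse z ^ n - 2"
      using power_plus_inverse_power[of z n n] that by (simp add: w_def)
    finally have "(- z) ^ n * poly ?q (- w) = z ^ n * (z ^ n + inverse z ^ n - 2)"
      by (simp add: power_minus[of z])
    also have "\<dots> = (z ^ n - 1)\<^sup>2"
      using that by (simp add: power2_eq_square algebra_simps flip: power_mult_distrib)
    also have "\<dots> = (- z) ^ n * poly ?p (- w)"
      using poly_char_poly_affine_cartan[OF assms, of z] that by (simp add: x)
    finally show ?thesis
      using that by (simp add: x)
  qed
  have "?p - ?q = 0"
  proof (rule ccontr)
    assume "?p - ?q \<noteq> 0"
    then have "finite {x. poly (?p - ?q) x = 0}"
      by (rule poly_roots_finite)
    moreover have "(\<lambda>z::real. 2 - z - 1 / z) ` {1<..} \<subseteq> {x. poly (?p - ?q) x = 0}"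
      using agree by auto
    ultimately show False
      using infinite_range_two_minus_plus_inverse finite_subset by blast
  qed
  then show ?thesis by simp
qed

end
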